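(* Let $\mathcal{H}$ be a complex separable Hilbert space and let $\mathcal{M},\mathcal{N}$ be (not necessarily closed) subspaces of $\mathcal{H}$. If $P_{\mathcal{M},\mathcal{N}}$ admits a $2\times 2$ block matrix representation with respect to $\overline{\mathcal{M}}$, then $$P_{\mathcal{M},\mathcal{N}}=\begin{pmatrix} P_{\mathcal{M},\,\overline{\mathcal{M}}\cap\mathcal{N}} & -P_{\mathcal{M}}\big((I-P_{\mathcal{M}})|_{\mathcal{N}}\big)^{-1}\\ 0&0\end{pmatrix}_{\overline{\mathcal{M}}}.$$
   Context: A linear relation from $\mathcal{H}$ to $\mathcal{K}$ is a linear subspace $T$ of $\mathcal{H}\times\mathcal{K}$; operators are identified with their graphs. $T^{-1}=\{(y,x):(x,y)\in T\}$, $-T=\{(u,-v):(u,v)\in T\}$, $RT=\{(x,y): (x,z)\in T,\ (z,y)\in R\text{ for some }z\}$, $T+S=\{(x,y+z):(x,y)\in T,(x,z)\in S\}$, $T|_{\mathcal{N}}=\{(x,y)\in T: x\in\mathcal{N}\}$. For subspaces $\mathcal{M},\mathcal{N}$ of $\mathcal{H}$, $P_{\mathcal{M},\mathcal{N}}:=\{(m+n,m): m\in\mathcal{M},\ n\in\mathcal{N}\}$ is the multivalued projection with range $\mathcal{M}$ and kernel $\mathcal{N}$. For a not necessarily closed subspace $\mathcal{M}$, $P_{\mathcal{M}}:=P_{\mathcal{M},\mathcal{M}^\perp}$, an operator with domain $\mathcal{M}\oplus\mathcal{M}^\perp$; thus $(I-P_{\mathcal{M}})|_{\mathcal{N}}=\{(n,n-P_{\mathcal{M}}n):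 n\in\mathcal{N}\cap(\mathcal{M}\oplus\mathcal{M}^\perp)\}$. The block $P_{\mathcal{M},\overline{\mathcal{M}}\cap\mathcal{N}}$ is regarded as a linear relation in $\overline{\mathcal{M}}\times\overline{\mathcal{M}}$ and the $(1,2)$ block as a linear relation from $\mathcal{M}^\perp$ to $\overline{\mathcal{M}}$. Block matrices: for a closed subspace $\mathcal{S}$ of $\mathcal{H}$ and linear relations $a$ from $\mathcal{S}$ to $\mathcal{S}$, $b$ from $\mathcal{S}^\perp$ to $\mathcal{S}$, $c$ from $\mathcal{S}$ to $\mathcal{S}^\perp$, $d$ from $\mathcal{S}^\perp$ to $\mathcal{S}^\perp$, $$\begin{pmatrix} a&b\\c&d\end{pmatrix}_{\mathcal{S}}:=\{(x_1+x_2,(w_1+z_1)+(w_2+z_2)):(x_1,w_1)\in a,\ (x_2,z_1)\in b,\ (x_1,w_2)\in c,\ (x_2,z_2)\in d\}.$$ A linear relation $T\subseteq\mathcal{H}\times\mathcal{H}$ admits a $2\times2$ block matrix representation with respect to $\mathcal{S}$ if there exist linear relations $a$ from $\mathcal{S}$ to $\mathcal{S}$, $b$ from $\mathcal{S}^\perp$ to $\mathcal{S}$, $c$ from $\mathcal{S}$ to $\mathcal{S}^\perp$ and $d$ from $\mathcal{S}^\perp$ to $\mathcal{S}^\perp$ with $T=\begin{pmatrix} a&b\\c&d\end{pmatrix}_{\mathcal{S}}$. Entries $0$ denote the everywhere defined zero operators between the corresponding subspaces. Equality is equality of linear relations. *)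

theory Defs
  imports "HOL-Analysis.Analysis"
begin

section \<open>Complex Hilbert spaces\<close>

text \<open>
  The distribution only has real inner product spaces. The topology, the norm and completeness
  come from \<^class>\<open>banach\<close>; the axioms tie them to a complex scalar multiplication and to an
  inner product that is linear in the first argument. Separability is not part of the class.
\<close>

class complex_hilbert_space = banach +
  fixes scaleC :: "complex \<Rightarrow> 'a \<Rightarrow> 'a" (infixr \<open>*\<^sub>C\<close> 75)
    and cinner :: "'a \<Rightarrow> 'a \<Rightarrow> complex"
  assumes scaleR_scaleC: "scaleR r x = complex_of_real r *\<^sub>C x"
    and scaleC_add_right: "c *\<^sub>C (x + y) = c *\<^sub>C x + c *\<^sub>C y"
    and scaleC_add_left: "(c + d) *\<^sub>C x = c *\<^sub>C x + d *\<^sub>C x"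
    and scaleC_scaleC: "c *\<^sub>C d *\<^sub>C x = (c * d) *\<^sub>C x"
    and scaleC_one: "1 *\<^sub>C x = x"
    and cinner_commute: "cinner x y = cnj (cinner y x)"
    and cinner_add_left: "cinner (x + y) z = cinner x z + cinner y z"
    and cinner_scaleC_left: "cinner (c *\<^sub>C x) y = c * cinner x y"
    and cinner_ge_zero: "0 \<le> Re (cinner x x)"
    and cinner_eq_zero_iff: "cinner x x = 0 \<longleftrightarrow> x = 0"
    and norm_eq_sqrt_cinner: "norm x = sqrt (Re (cinner x x))"

global_interpretation complex_vector:
  vector_space "scaleC :: complex \<Rightarrow> 'a \<Rightarrow> 'a::complex_hilbert_space"
  by unfold_locales (rule scaleC_add_right scaleC_add_left scaleC_scaleC scaleC_one)+

abbreviation csubspace :: "'a::complex_hilbert_space set \<Rightarrow> bool"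
  where "csubspace \<equiv> complex_vector.subspace"

instantiation complex :: complex_hilbert_space
begin

definition scaleC_complex :: "complex \<Rightarrow> complex \<Rightarrow> complex"
  where "scaleC_complex c x = c * x"

definition cinner_complex :: "complex \<Rightarrow> complex \<Rightarrow> complex"
  where "cinner_complex x y = x * cnj y"

instance
  by standard
    (auto simp: scaleC_complex_def cinner_complex_def scaleR_conv_of_real algebra_simps
      cmod_def power2_eq_square)

end

instantiation prod :: (complex_hilbert_space, complex_hilbert_space) complex_hilbert_space
begin

definition scaleC_prod :: "complex \<Rightarrow> 'a \<times> 'b \<Rightarrow> 'a \<times> 'b"
  where "scaleC_prod c p = (c *\<^sub>C fst p, c *\<^sub>C snd p)"

definition cinner_prod :: "'a \<times> 'b \<Rightarrow> 'a \<times> 'b \<Rightarrow> complex"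
  where "cinner_prod p q = cinner (fst p) (fst q) + cinner (snd p) (snd q)"

instance
proof
  fix p q s :: "'a \<times> 'b" and r :: real and c d :: complex
  show "scaleR r p = complex_of_real r *\<^sub>C p"
    by (simp add: scaleC_prod_def scaleR_prod_def scaleR_scaleC)
  show "c *\<^sub>C (p + q) = c *\<^sub>C p + c *\<^sub>C q"
    by (simp add: scaleC_prod_def scaleC_add_right)
  show "(c + d) *\<^sub>C p = c *\<^sub>C p + d *\<^sub>C p"
    by (simp add: scaleC_prod_def scaleC_add_left)
  show "c *\<^sub>C d *\<^sub>C p = (c * d) *\<^sub>C p"
    by (simp add: scaleC_prod_def scaleC_scaleC)
  show "1 *\<^sub>C p = p"
    by (simp add: scaleC_prod_def scaleC_one)
  show "cinner p q = cnj (cinner q p)"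
    by (simp add: cinner_prod_def cinner_commute[of "fst p"] cinner_commute[of "snd p"])
  show "cinner (p + q) s = cinner p s + cinner q s"
    by (simp add: cinner_prod_def cinner_add_left)
  show "cinner (c *\<^sub>C p) q = c * cinner p q"
    by (simp add: cinner_prod_def scaleC_prod_def cinner_scaleC_left distrib_left)
  show "0 \<le> Re (cinner p p)"
    by (simp add: cinner_prod_def cinner_ge_zero)
  show "norm p = sqrt (Re (cinner p p))"
    by (simp add: cinner_prod_def norm_prod_def norm_eq_sqrt_cinner cinner_ge_zero)
  then have "p = 0" if "cinner p p = 0"
    using that by simp
  then show "cinner p p = 0 \<longleftrightarrow> p = 0"
    by (auto simp: cinner_prod_def cinner_eq_zero_iff[THEN iffD2])
qed

end

definition ocomp :: "'a::complex_hilbert_space set \<Rightarrow> 'a set"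
  where "ocomp M = {x. \<forall>m\<in>M. cinner x m = 0}"

section \<open>Linear relations\<close>

text \<open>
  Linear relations are sets of pairs, and operators are identified with their graphs. The inverse
  is \<^term>\<open>T\<inverse>\<close>. The product \<open>R T\<close> (first \<open>T\<close>, then \<open>R\<close>) is \<^term>\<open>T O R\<close>, as relation
  composition in HOL is written in diagrammatic order. The identity operator is \<^term>\<open>Id\<close>.
\<close>

definition linear_relation ::
  "'a::complex_hilbert_space set \<Rightarrow> 'b::complex_hilbert_space set \<Rightarrow> ('a \<times> 'b) set \<Rightarrow> bool"
  where "linear_relation A B T \<longleftrightarrow> csubspace T \<and> T \<subseteq> A \<times> B"

definition rel_uminus :: "('a \<times> 'b::complex_hilbert_space) set \<Rightarrow> ('a \<times> 'b) set"
  where "rel_uminus T = {(u, - v) | u v. (u, v) \<in> T}"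

definition rel_plus ::
  "('a \<times> 'b::complex_hilbert_space) set \<Rightarrow> ('a \<times> 'b) set \<Rightarrow> ('a \<times> 'b) set"
  where "rel_plus T S = {(x, y + z) | x y z. (x, y) \<in> T \<and> (x, z) \<in> S}"

definition rel_restrict :: "('a \<times> 'b) set \<Rightarrow> 'a set \<Rightarrow> ('a \<times> 'b) set"
  where "rel_restrict T N = {(x, y). (x, y) \<in> T \<and> x \<in> N}"

definition mproj :: "'a::complex_hilbert_space set \<Rightarrow> 'a set \<Rightarrow> ('a \<times> 'a) set"
  where "mproj M N = {(m + n, m) | m n. m \<in> M \<and> n \<in> N}"

definition oproj :: "'a::complex_hilbert_space set \<Rightarrow> ('a \<times> 'a) set"
  where "oproj M = mproj M (ocomp M)"

definition zero_op :: "'a set \<Rightarrow> ('a \<times> 'b::complex_hilbert_space) set"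
  where "zero_op A = {(x, 0) | x. x \<in> A}"

section \<open>Block matrices\<close>

text \<open>
  The subspace \<open>S\<close> does not occur in the formula for the matrix: it only prescribes between which
  subspaces the entries act, which is recorded in \<open>block_entries\<close>.
\<close>

definition block_entries :: "'a::complex_hilbert_space set \<Rightarrow> ('a \<times> 'a) set \<Rightarrow> ('a \<times> 'a) set \<Rightarrow>
    ('a \<times> 'a) set \<Rightarrow> ('a \<times> 'a) set \<Rightarrow> bool"
  where "block_entries S a b c d \<longleftrightarrow>
    linear_relation S S a \<and> linear_relation (ocomp S) S b \<and>
    linear_relation S (ocomp S) c \<and> linear_relation (ocomp S) (ocomp S) d"

definition block_matrix :: "('a::complex_hilbert_space \<times> 'a) set \<Rightarrow> ('a \<times> 'a) set \<Rightarrow>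
    ('a \<times> 'a) set \<Rightarrow> ('a \<times> 'a) set \<Rightarrow> ('a \<times> 'a) set"
  where "block_matrix a b c d =
    {(x1 + x2, (w1 + z1) + (w2 + z2)) | x1 x2 w1 z1 w2 z2.
       (x1, w1) \<in> a \<and> (x2, z1) \<in> b \<and> (x1, w2) \<in> c \<and> (x2, z2) \<in> d}"

definition admits_block_matrix :: "'a::complex_hilbert_space set \<Rightarrow> ('a \<times> 'a) set \<Rightarrow> bool"
  where "admits_block_matrix S T \<longleftrightarrow>
    (\<exists>a b c d. block_entries S a b c d \<and> T = block_matrix a b c d)"

section \<open>The entries of the block matrix in the theorem\<close>

lemma csubspaceI:
  assumes "0 \<in> S" "\<And>x y. x \<in> S \<Longrightarrow> y \<in> S \<Longrightarrow> x + y \<in> S" "\<And>c x. x \<in> S \<Longrightarrow> c *\<^sub>C x \<in> S"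
  shows "csubspace S"
  using assms by (simp add: complex_vector.subspace_def)

lemmas csubspace_0 = complex_vector.subspace_0
  and csubspace_add = complex_vector.subspace_add
  and csubspace_scale = complex_vector.subspace_scale

lemma scaleC_Pair: "c *\<^sub>C (x, y) = (c *\<^sub>C x, c *\<^sub>C y)"
  by (simp add: scaleC_prod_def)

lemma csubspace_relI:
  assumes "(0, 0) \<in> T"
    and "\<And>x y u v. (x, y) \<in> T \<Longrightarrow> (u, v) \<in> T \<Longrightarrow> (x + u, y + v) \<in> T"
    and "\<And>c x y. (x, y) \<in> T \<Longrightarrow> (c *\<^sub>C x, c *\<^sub>C y) \<in> T"
  shows "csubspace T"
  using assms by (intro csubspaceI) (auto simp: zero_prod_def scaleC_Pair)

lemma csubspace_relD:
  assumes "csubspace T"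
  shows "(0, 0) \<in> T"
    and "(x, y) \<in> T \<Longrightarrow> (u, v) \<in> T \<Longrightarrow> (x + u, y + v) \<in> T"
    and "(x, y) \<in> T \<Longrightarrow> (c *\<^sub>C x, c *\<^sub>C y) \<in> T"
  using csubspace_0[OF assms] csubspace_add[OF assms, of "(x, y)" "(u, v)"]
    csubspace_scale[OF assms, of "(x, y)" c]
  by (simp_all add: zero_prod_def scaleC_Pair)

lemma norm_scaleC: "norm (c *\<^sub>C x) = cmod c * norm (x :: 'a::complex_hilbert_space)"
proof -
  have "cinner (c *\<^sub>C x) (c *\<^sub>C x) = c * cnj (c * cinner x x)"
    by (metis cinner_commute cinner_scaleC_left)
  also have "\<dots> = of_real ((cmod c)\<^sup>2) * cinner x x"
    by (metis cinner_commute complex_cnj_mult complex_norm_square mult.assoc)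
  finally have "Re (cinner (c *\<^sub>C x) (c *\<^sub>C x)) = (cmod c)\<^sup>2 * Re (cinner x x)"
    by (simp only: Re_complex_of_real Im_complex_of_real times_complex.sel mult_zero_left diff_zero)
  then show ?thesis
    by (simp add: norm_eq_sqrt_cinner[where 'a = 'a] real_sqrt_mult)
qed

lemma bounded_linear_scaleC: "bounded_linear (\<lambda>x :: 'a::complex_hilbert_space. c *\<^sub>C x)"
  by (rule bounded_linear_intro[where K = "cmod c"])
    (simp_all add: scaleC_add_right scaleR_scaleC scaleC_scaleC norm_scaleC mult.commute)

lemma csubspace_closure:
  assumes "csubspace M"
  shows "csubspace (closure M)"
proof (rule csubspaceI)
  show "0 \<in> closure M"
    using csubspace_0[OF assms] closure_subset by blast
next
  fix x y assume "x \<in> closure M" "y \<in> closure M"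
  then obtain f g where "\<And>n. f n \<in> M" "f \<longlonglongrightarrow> x" "\<And>n. g n \<in> M" "g \<longlonglongrightarrow> y"
    by (metis closure_sequential)
  then have "(\<lambda>n. f n + g n) \<longlonglongrightarrow> x + y" "\<And>n. f n + g n \<in> M"
    by (auto intro: tendsto_add csubspace_add[OF assms])
  then show "x + y \<in> closure M"
    unfolding closure_sequential by (intro exI conjI allI)
next
  fix c x assume "x \<in> closure M"
  then obtain f where "\<And>n. f n \<in> M" "f \<longlonglongrightarrow> x"
    by (metis closure_sequential)
  then have "(\<lambda>n. c *\<^sub>C f n) \<longlonglongrightarrow> c *\<^sub>C x" "\<And>n. c *\<^sub>C f n \<in> M"
    by (auto intro: bounded_linear.tendsto[OF bounded_linear_scaleC] csubspace_scale[OF assms])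
  then show "c *\<^sub>C x \<in> closure M"
    unfolding closure_sequential by (intro exI conjI allI)
qed

lemma csubspace_ocomp: "csubspace (ocomp M)"
  by (rule csubspaceI)
    (auto simp: ocomp_def cinner_add_left cinner_scaleC_left
      cinner_scaleC_left[of 0, simplified])

lemma norm_add_cinner:
  "(norm (x + y))\<^sup>2 = (norm x)\<^sup>2 + (norm y)\<^sup>2 + 2 * Re (cinner x (y :: 'a::complex_hilbert_space))"
proof -
  have right: "cinner u (x + y) = cinner u x + cinner u y" for u
    by (metis cinner_add_left cinner_commute complex_cnj_add)
  have "Re (cinner y x) = Re (cinner x y)"
    by (metis cinner_commute complex_cnj(1) complex.sel(1) complex_surj)
  moreover have "(norm u)\<^sup>2 = Re (cinner u u)" for u :: 'a
    by (simp add: norm_eq_sqrt_cinner cinner_ge_zero)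
  ultimately show ?thesis
    by (simp add: cinner_add_left right)
qed

lemma closed_cinner_zero: "closed {y. cinner x (y :: 'a::complex_hilbert_space) = 0}"
proof -
  have re: "Re (cinner x y) = ((norm (x + y))\<^sup>2 - (norm x)\<^sup>2 - (norm y)\<^sup>2) / 2" for y
    using norm_add_cinner[of x y] by simp
  have "cinner x (\<i> *\<^sub>C y) = - \<i> * cinner x y" for y
    by (metis cinner_commute cinner_scaleC_left complex_cnj_i complex_cnj_mult)
  then have "Im (cinner x y) = Re (cinner x (\<i> *\<^sub>C y))" for y
    by simp
  then have "{y. cinner x y = 0} = {y. Re (cinner x y) = 0} \<inter> {y. Re (cinner x (\<i> *\<^sub>C y)) = 0}"
    by (auto simp: complex_eq_iff)
  then show ?thesis
    unfolding re
    by (auto intro!: closed_Int closed_Collect_eq continuous_intros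
        bounded_linear.continuous_on[OF bounded_linear_scaleC])
qed

lemma ocomp_closure: "ocomp (closure M) = ocomp M"
proof
  show "ocomp (closure M) \<subseteq> ocomp M"
    using closure_subset by (fastforce simp: ocomp_def)
  show "ocomp M \<subseteq> ocomp (closure M)"
  proof
    fix x assume "x \<in> ocomp M"
    then have "M \<subseteq> {y. cinner x y = 0}"
      by (auto simp: ocomp_def)
    then have "closure M \<subseteq> {y. cinner x y = 0}"
      by (rule closure_minimal) (rule closed_cinner_zero)
    then show "x \<in> ocomp (closure M)"
      by (auto simp: ocomp_def)
  qed
qed

lemma csubspace_mproj:
  assumes "csubspace M" "csubspace N"
  shows "csubspace (mproj M N)"
proof (rule csubspace_relI)
  show "(0, 0) \<in> mproj M N"
    using csubspace_0[OF assms(1)] csubspace_0[OF assms(2)] by (force simp: mproj_def)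
next
  fix x y u v assume "(x, y) \<in> mproj M N" "(u, v) \<in> mproj M N"
  then obtain n n' where "x = y + n" "u = v + n'" "y \<in> M" "v \<in> M" "n \<in> N" "n' \<in> N"
    by (auto simp: mproj_def)
  moreover from this have "y + v \<in> M" "n + n' \<in> N" "x + u = (y + v) + (n + n')"
    using assms by (auto intro: csubspace_add simp: algebra_simps)
  ultimately show "(x + u, y + v) \<in> mproj M N"
    unfolding mproj_def by blast
next
  fix c x y assume "(x, y) \<in> mproj M N"
  then obtain n where "x = y + n" "y \<in> M" "n \<in> N"
    by (auto simp: mproj_def)
  then have "c *\<^sub>C x = c *\<^sub>C y + c *\<^sub>C n" "c *\<^sub>C y \<in> M" "c *\<^sub>C n \<in> N"
    using assms by (auto intro: csubspace_scale simp: scaleC_add_right)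
  then show "(c *\<^sub>C x, c *\<^sub>C y) \<in> mproj M N"
    unfolding mproj_def by blast
qed

lemma csubspace_zero_op:
  assumes "csubspace A"
  shows "csubspace (zero_op A)"
  using csubspace_0[OF assms] csubspace_add[OF assms] csubspace_scale[OF assms]
  by (intro csubspace_relI) (auto simp: zero_op_def)

lemma csubspace_Id: "csubspace Id"
  by (rule csubspace_relI) auto

lemma csubspace_rel_uminus:
  assumes "csubspace T"
  shows "csubspace (rel_uminus T)"
proof (rule csubspace_relI)
  have *: "(x, y) \<in> rel_uminus T \<longleftrightarrow> (x, - y) \<in> T" for x y
    by (force simp: rel_uminus_def)
  show "(0, 0) \<in> rel_uminus T"
    using csubspace_relD(1)[OF assms] by (simp add: *)
  show "(x + u, y + v) \<in> rel_uminus T"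
    if "(x, y) \<in> rel_uminus T" "(u, v) \<in> rel_uminus T" for x y u v
    using csubspace_relD(2)[OF assms, of x "- y" u "- v"] that by (simp add: *)
  show "(c *\<^sub>C x, c *\<^sub>C y) \<in> rel_uminus T" if "(x, y) \<in> rel_uminus T" for c x y
    using csubspace_relD(3)[OF assms, of x "- y" c] that by (simp add: *)
qed

lemma csubspace_rel_plus:
  assumes "csubspace T" "csubspace S"
  shows "csubspace (rel_plus T S)"
proof (rule csubspace_relI)
  show "(0, 0) \<in> rel_plus T S"
    using csubspace_relD(1)[OF assms(1)] csubspace_relD(1)[OF assms(2)]
    by (force simp: rel_plus_def)
next
  fix x y u v assume "(x, y) \<in> rel_plus T S" "(u, v) \<in> rel_plus T S"
  then obtain y1 y2 v1 v2 where "y = y1 + y2" "v = v1 + v2"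
    "(x, y1) \<in> T" "(x, y2) \<in> S" "(u, v1) \<in> T" "(u, v2) \<in> S"
    by (auto simp: rel_plus_def)
  moreover from this have "(x + u, y1 + v1) \<in> T" "(x + u, y2 + v2) \<in> S"
    "y + v = (y1 + v1) + (y2 + v2)"
    using assms by (auto intro: csubspace_relD simp: algebra_simps)
  ultimately show "(x + u, y + v) \<in> rel_plus T S"
    unfolding rel_plus_def by blast
next
  fix c x y assume "(x, y) \<in> rel_plus T S"
  then obtain y1 y2 where "y = y1 + y2" "(x, y1) \<in> T" "(x, y2) \<in> S"
    by (auto simp: rel_plus_def)
  then have "c *\<^sub>C y = c *\<^sub>C y1 + c *\<^sub>C y2" "(c *\<^sub>C x, c *\<^sub>C y1) \<in> T" "(c *\<^sub>C x, c *\<^sub>C y2) \<in> S"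
    using assms by (auto intro: csubspace_relD simp: scaleC_add_right)
  then show "(c *\<^sub>C x, c *\<^sub>C y) \<in> rel_plus T S"
    unfolding rel_plus_def by blast
qed

lemma csubspace_rel_restrict:
  assumes "csubspace T" "csubspace N"
  shows "csubspace (rel_restrict T N)"
  using csubspace_relD[OF assms(1)] csubspace_0[OF assms(2)] csubspace_add[OF assms(2)]
    csubspace_scale[OF assms(2)]
  by (intro csubspace_relI) (auto simp: rel_restrict_def)

lemma csubspace_converse:
  assumes "csubspace T"
  shows "csubspace (T\<inverse>)"
  using csubspace_relD[OF assms] by (intro csubspace_relI) auto

lemma csubspace_relcomp:
  assumes "csubspace T" "csubspace R"
  shows "csubspace (T O R)"
  using csubspace_relD[OF assms(1)] csubspace_relD[OF assms(2)]
  by (intro csubspace_relI) (auto intro!: relcompI)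

lemma block_entries_mproj:
  assumes "csubspace M" "csubspace N"
  shows "block_entries (closure M)
    (mproj M (closure M \<inter> N))
    (rel_uminus ((rel_restrict (rel_plus Id (rel_uminus (oproj M))) N)\<inverse> O oproj M))
    (zero_op (closure M))
    (zero_op (ocomp (closure M)))"
proof -
  note cl = csubspace_closure[OF assms(1)]
  have oproj: "csubspace (oproj M)"
    unfolding oproj_def by (intro csubspace_mproj csubspace_ocomp assms)
  have "linear_relation (closure M) (closure M) (mproj M (closure M \<inter> N))"
    unfolding linear_relation_def
  proof
    show "csubspace (mproj M (closure M \<inter> N))"
      by (intro csubspace_mproj complex_vector.subspace_inter cl assms)
    show "mproj M (closure M \<inter> N) \<subseteq> closure M \<times> closure M"
      using csubspace_add[OF cl] closure_subset[of M] by (auto simp: mproj_def)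
  qed
  moreover
  have "linear_relation (ocomp (closure M)) (closure M)
    (rel_uminus ((rel_restrict (rel_plus Id (rel_uminus (oproj M))) N)\<inverse> O oproj M))"
    (is "linear_relation _ _ (rel_uminus (?X\<inverse> O oproj M))")
  proof -
    have "csubspace (rel_uminus (?X\<inverse> O oproj M))"
      by (intro csubspace_rel_uminus csubspace_relcomp csubspace_converse csubspace_rel_restrict
          csubspace_rel_plus csubspace_Id oproj assms)
    moreover have "?X \<subseteq> UNIV \<times> ocomp (closure M)"
      by (auto simp: rel_restrict_def rel_plus_def rel_uminus_def oproj_def mproj_def ocomp_closure)
    moreover have "(x, - y) \<in> UNIV \<times> closure M" if "(x, y) \<in> oproj M" for x y
      using that complex_vector.subspace_neg[OF cl] closure_subset[of M]
      by (auto simp: oproj_def mproj_def)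
    ultimately show ?thesis
      unfolding linear_relation_def rel_uminus_def[of "_ O _"] by blast
  qed
  moreover have "linear_relation (closure M) (ocomp (closure M)) (zero_op (closure M))"
    "linear_relation (ocomp (closure M)) (ocomp (closure M)) (zero_op (ocomp (closure M)))"
    using csubspace_zero_op[OF cl] csubspace_zero_op[OF csubspace_ocomp[of "closure M"]]
      csubspace_0[OF csubspace_ocomp[of "closure M"]]
    by (auto simp: linear_relation_def zero_op_def)
  ultimately show ?thesis
    by (simp add: block_entries_def)
qed

end

theory Submission
  imports Defs
begin

text \<open>
  A block representation allows each of the two components of a vector in the domain to be mapped
  separately (taking the other one to be \<open>0\<close>). As the range \<open>M\<close> of the projection is orthogonal to
  \<open>ocomp (closure M)\<close>, the second row then only contributes \<open>0\<close>, and what remains lies in the two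
  entries of the first row. The reverse inclusion holds without a block representation.
\<close>

lemma ocomp_disjoint: "x \<in> M \<Longrightarrow> x \<in> ocomp M \<Longrightarrow> x = 0"
  using cinner_eq_zero_iff[of x] by (simp add: ocomp_def)

lemma mem_mproj_iff: "(x, y) \<in> mproj M N \<longleftrightarrow> y \<in> M \<and> x - y \<in> N"
proof
  assume "y \<in> M \<and> x - y \<in> N"
  moreover have "(x, y) = (y + (x - y), y)"
    by simp
  ultimately show "(x, y) \<in> mproj M N"
    unfolding mproj_def by blast
qed (auto simp: mproj_def)

lemma mem_rel_uminus_iff: "(x, y) \<in> rel_uminus T \<longleftrightarrow> (x, - y) \<in> T"
  by (force simp: rel_uminus_def)

lemma mem_rel_plus_Id_iff: "(x, y) \<in> rel_plus Id T \<longleftrightarrow> (x, y - x) \<in> T"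
proof
  assume "(x, y - x) \<in> T"
  moreover have "(x, y) = (x, x + (y - x))"
    by simp
  ultimately show "(x, y) \<in> rel_plus Id T"
    unfolding rel_plus_def by blast
qed (auto simp: rel_plus_def)

text \<open>The vector \<open>u\<close> in \<open>N\<close> linking the two factors satisfies
  \<open>P u = u - x\<close> and \<open>P u = - y\<close> for the operator
  \<open>P = oproj M\<close>. Single-valuedness of \<open>P\<close> forces \<open>u = x - y\<close>,
  so the entry is just \<open>mproj M N\<close> restricted to \<open>ocomp M\<close>.\<close>

lemma mem_block_12_iff:
  assumes "csubspace M"
  shows "(x, y) \<in> rel_uminus ((rel_restrict (rel_plus Id (rel_uminus (oproj M))) N)\<inverse> O oproj M)
    \<longleftrightarrow> x \<in> ocomp M \<and> y \<in> M \<and> x - y \<in> N"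
proof -
  have P: "(u, v) \<in> oproj M \<longleftrightarrow> v \<in> M \<and> u - v \<in> ocomp M" for u v
    by (simp add: oproj_def mem_mproj_iff)
  \<comment> \<open>The differences \<open>v - w\<close> and \<open>(u - w) - (u - v)\<close> are
    the same vector, which thus lies both in \<open>M\<close> and in \<open>ocomp M\<close>.\<close>
  have unique: "v = w" if "(u, v) \<in> oproj M" "(u, w) \<in> oproj M" for u v w
  proof -
    have "v - w \<in> M"
      using that complex_vector.subspace_diff[OF assms] by (simp add: P)
    moreover have "(u - w) - (u - v) \<in> ocomp M"
      using that by (simp only: P complex_vector.subspace_diff[OF csubspace_ocomp])
    ultimately show ?thesis
      using ocomp_disjoint[of "v - w" M] by simp
  qed
  have "(x, y) \<in> rel_uminus ((rel_restrict (rel_plus Id (rel_uminus (oproj M))) N)\<inverse> O oproj M)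
    \<longleftrightarrow> (\<exists>u\<in>N. (u, u - x) \<in> oproj M \<and> (u, - y) \<in> oproj M)"
    by (auto simp: mem_rel_uminus_iff mem_rel_plus_Id_iff rel_restrict_def relcomp_unfold)
  also have "\<dots> \<longleftrightarrow> x - y \<in> N \<and> (x - y, - y) \<in> oproj M"
  proof
    assume "\<exists>u\<in>N. (u, u - x) \<in> oproj M \<and> (u, - y) \<in> oproj M"
    then obtain u where "u \<in> N" and u: "(u, u - x) \<in> oproj M" "(u, - y) \<in> oproj M"
      by blast
    moreover have "u = x - y"
      using unique[OF u] by (simp add: algebra_simps)
    ultimately show "x - y \<in> N \<and> (x - y, - y) \<in> oproj M"
      by simp
  qed (auto intro!: bexI[of _ "x - y"])
  \<comment> \<open>The residual of the pair \<open>(x - y, - y)\<close> is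
    \<open>(x - y) - (- y) = x\<close>, whence the condition \<open>x \<in> ocomp M\<close>.\<close>
  also have "\<dots> \<longleftrightarrow> x \<in> ocomp M \<and> y \<in> M \<and> x - y \<in> N"
    using complex_vector.subspace_neg[OF assms, of y] complex_vector.subspace_neg[OF assms, of "- y"]
    by (auto simp: P)
  finally show ?thesis .
qed

theorem theorem3p8:
  fixes M N :: "'a::complex_hilbert_space set"
  assumes "separable_space (euclidean :: 'a topology)"
    and "csubspace M" and "csubspace N"
    and "admits_block_matrix (closure M) (mproj M N)"
  shows "mproj M N =
    block_matrix
      (mproj M (closure M \<inter> N))
      (rel_uminus ((rel_restrict (rel_plus Id (rel_uminus (oproj M))) N)\<inverse> O oproj M))
      (zero_op (closure M))
      (zero_op (ocomp (closure M)))"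
    (is "_ = block_matrix ?a ?b ?c ?d")
proof (intro equalityI subrelI)
  let ?S = "closure M"
  note S = csubspace_closure[OF assms(2)]
  note b_iff = mem_block_12_iff[OF assms(2), of _ _ N]
  fix x y assume xy: "(x, y) \<in> mproj M N"
  obtain a b c d where ent: "block_entries ?S a b c d" and T: "mproj M N = block_matrix a b c d"
    using assms(4) by (auto simp: admits_block_matrix_def)
  obtain x1 x2 w1 z1 w2 z2 where x: "x = x1 + x2" and y: "y = (w1 + z1) + (w2 + z2)"
    and mem: "(x1, w1) \<in> a" "(x2, z1) \<in> b" "(x1, w2) \<in> c" "(x2, z2) \<in> d"
    using xy unfolding T block_matrix_def by blast
  have zero: "(0, 0) \<in> a" "(0, 0) \<in> b" "(0, 0) \<in> c" "(0, 0) \<in> d"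
    using ent csubspace_relD(1) by (auto simp: block_entries_def linear_relation_def)
  have sp: "x1 \<in> ?S" "w1 \<in> ?S" "x2 \<in> ocomp ?S" "z1 \<in> ?S" "w2 \<in> ocomp ?S" "z2 \<in> ocomp ?S"
    using ent mem by (auto simp: block_entries_def linear_relation_def)
  \<comment> \<open>As \<open>M\<close> is contained in \<open>?S\<close>, the vector
    \<open>v = (u + v) - u\<close> lies in \<open>?S\<close> and is also orthogonal to
    \<open>?S\<close>.\<close>
  have drop: "v = 0" if "u + v \<in> M" "u \<in> ?S" "v \<in> ocomp ?S" for u v
  proof -
    have "(u + v) - u \<in> ?S"
      using that closure_subset by (intro complex_vector.subspace_diff[OF S]) auto
    then show ?thesis
      using that ocomp_disjoint by simp
  qed
  \<comment> \<open>The pairs \<open>(0, 0)\<close> in \<open>b\<close> and \<open>d\<close> isolate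
    the first column; those in \<open>a\<close> and \<open>c\<close> isolate the second one
    below.\<close>
  have "(x1 + 0, (w1 + 0) + (w2 + 0)) \<in> mproj M N"
    unfolding T block_matrix_def using mem zero by blast
  then have 1: "w1 + w2 \<in> M" "x1 - (w1 + w2) \<in> N"
    by (simp_all add: mem_mproj_iff)
  have "(0 + x2, (0 + z1) + (0 + z2)) \<in> mproj M N"
    unfolding T block_matrix_def using mem zero by blast
  then have 2: "z1 + z2 \<in> M" "x2 - (z1 + z2) \<in> N"
    by (simp_all add: mem_mproj_iff)
  have [simp]: "w2 = 0" "z2 = 0"
    using drop[OF 1(1)] drop[OF 2(1)] sp by simp_all
  \<comment> \<open>Both \<open>x1\<close> and \<open>w1\<close> lie in \<open>?S\<close>, so
    \<open>x1 - w1\<close> falls into the smaller kernel \<open>?S \<inter> N\<close>.\<close>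
  have "(x1, w1) \<in> ?a"
    using 1 sp complex_vector.subspace_diff[OF S] by (simp add: mem_mproj_iff)
  moreover have "(x2, z1) \<in> ?b"
    using 2 sp by (simp add: b_iff ocomp_closure)
  moreover have "(x1, 0) \<in> ?c" "(x2, 0) \<in> ?d"
    using sp by (simp_all add: zero_op_def)
  moreover have "y = (w1 + z1) + (0 + 0)"
    by (simp add: y)
  ultimately show "(x, y) \<in> block_matrix ?a ?b ?c ?d"
    unfolding block_matrix_def x by blast
next
  fix x y assume "(x, y) \<in> block_matrix ?a ?b ?c ?d"
  then obtain x1 x2 w z where xy: "x = x1 + x2" "y = w + z"
    and "(x1, w) \<in> ?a" "(x2, z) \<in> ?b"
    by (auto simp: block_matrix_def zero_op_def)
  \<comment> \<open>Both entries of the first row are contained in \<open>mproj M N\<close>, and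
    additivity of \<open>M\<close> and \<open>N\<close> combines the two pairs.\<close>
  then have "w \<in> M" "z \<in> M" "x1 - w \<in> N" "x2 - z \<in> N"
    by (simp_all add: mem_mproj_iff mem_block_12_iff[OF assms(2)])
  then have "w + z \<in> M" "(x1 - w) + (x2 - z) \<in> N"
    using csubspace_add assms(2,3) by blast+
  then show "(x, y) \<in> mproj M N"
    by (simp add: xy mem_mproj_iff algebra_simps)
qed

end
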